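(* Let $(M,P,g)$ be a Riemannian $\mathcal{W}_3$-manifold. Then its curvature tensor $R$ satisfies, for all smooth vector fields $x,y,z,w$ on $M$, $$\mathop{\mathfrak{S}}_{x,y,z}\bigl\{R(x,Py,Pz,w)-R(x,Py,z,Pw)+R(Px,y,z,Pw)-R(Px,y,Pz,w)\bigr\}$$ $$=\mathop{\mathfrak{S}}_{x,y,z} g\bigl((\nabla_x P)y+(\nabla_y P)x,\ (\nabla_z P)w+(\nabla_w P)z\bigr).$$
   Context: A Riemannian almost product manifold $(M,P,g)$ is a smooth manifold $M$ with a $(1,1)$-tensor field $P$ and a Riemannian metric $g$ such that $P^2x=x$ and $g(Px,Py)=g(x,y)$ for all smooth vector fields $x,y$; it is assumed throughout that $\mathrm{tr}\,P=0$ (so $\dim M$ is even). Let $\nabla$ be the Levi-Civita connection of $g$ and $F(x,y,z)=g((\nabla_xP)y,z)$. $\mathop{\mathfrak{S}}_{x,y,z}$ denotes the cyclic sum over $x,y,z$. A Riemannian $\mathcal{W}_3$-manifold is a Riemannian almost product manifold (with $\mathrm{tr}\,P=0$) satisfying $\mathop{\mathfrak{S}}_{x,y,z}F(x,y,z)=0$ for all $x,y,z$. The curvature tensor is $R(x,y)z=\nabla_x\nabla_yz-\nabla_y\nabla_xz-\nabla_{[x,y]}z$ and $R(x,y,z,w)=g(R(x,y)z,w)$. *)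

theory Defs
  imports "HOL-Analysis.Analysis" "HOL-Library.Function_Algebras"
begin

section \<open>Functions as a real vector space\<close>

instantiation "fun" :: (type, real_vector) real_vector
begin

definition scaleR_fun :: "real \<Rightarrow> ('a \<Rightarrow> 'b) \<Rightarrow> 'a \<Rightarrow> 'b"
  where "c *\<^sub>R f = (\<lambda>x. c *\<^sub>R f x)"

instance
  by standard (simp_all add: scaleR_fun_def plus_fun_def scaleR_add_right scaleR_add_left)

end

lemma scaleR_fun_apply [simp]: "(c *\<^sub>R f) x = c *\<^sub>R f x"
  by (simp add: scaleR_fun_def)

section \<open>Smooth manifolds\<close>

text \<open>Only used for open S, where the Frechet derivative at a point of S is unique.\<close>

primrec Ck_on ::
    "nat \<Rightarrow> ('e::euclidean_space \<Rightarrow> 'f::real_normed_vector) \<Rightarrow> 'e set \<Rightarrow> bool"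
  where
    "Ck_on 0 f S \<longleftrightarrow> continuous_on S f"
  | "Ck_on (Suc k) f S \<longleftrightarrow>
       (\<forall>x\<in>S. f differentiable (at x)) \<and>
       (\<forall>v. Ck_on k (\<lambda>x. frechet_derivative f (at x) v) S)"

definition smooth_on ::
    "'e::euclidean_space set \<Rightarrow> ('e \<Rightarrow> 'f::real_normed_vector) \<Rightarrow> bool"
  where "smooth_on S f \<longleftrightarrow> (\<forall>k. Ck_on k f S)"

text \<open>The manifold is the whole type \<open>'a\<close>; a chart is a pair of a domain and a
  coordinate map into the model space \<open>'e\<close>, whose dimension is that of the manifold.
  The values of the coordinate map outside the domain are irrelevant.\<close>

type_synonym ('a, 'e) chart = "'a set \<times> ('a \<Rightarrow> 'e)"

definition chart_inv :: "('a, 'e) chart \<Rightarrow> 'e \<Rightarrow> 'a"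
  where "chart_inv c = inv_into (fst c) (snd c)"

locale smooth_manifold =
  fixes A :: "('a::{t2_space,second_countable_topology}, 'e::euclidean_space) chart set"
  assumes chart_open: "c \<in> A \<Longrightarrow> open (fst c) \<and> open (snd c ` fst c)"
    and chart_homeo: "c \<in> A \<Longrightarrow> homeomorphism (fst c) (snd c ` fst c) (snd c) (chart_inv c)"
    and charts_cover: "(\<Union>c\<in>A. fst c) = UNIV"
    and charts_compatible:
      "c \<in> A \<Longrightarrow> d \<in> A \<Longrightarrow> smooth_on (snd c ` (fst c \<inter> fst d)) (snd d \<circ> chart_inv c)"

definition smooth_fun ::
    "('a, 'e::euclidean_space) chart set \<Rightarrow> ('a \<Rightarrow> real) \<Rightarrow> bool"
  where "smooth_fun A f \<longleftrightarrow> (\<forall>c\<in>A. smooth_on (snd c ` fst c) (f \<circ> chart_inv c))"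

section \<open>Tangent spaces and vector fields\<close>

type_synonym 'a tangent = "('a \<Rightarrow> real) \<Rightarrow> real"
type_synonym 'a field = "'a \<Rightarrow> 'a tangent"

text \<open>Tangent vectors at \<open>p\<close> are the derivations at \<open>p\<close> of the algebra of smooth
  functions. As functions in HOL are total, a derivation is given the value 0 on non-smooth
  functions, so that each derivation is represented by exactly one element.\<close>

definition tangent_space ::
    "('a, 'e::euclidean_space) chart set \<Rightarrow> 'a \<Rightarrow> 'a tangent set"
  where "tangent_space A p = {v.
     (\<forall>f h. smooth_fun A f \<longrightarrow> smooth_fun A h \<longrightarrow> v (f + h) = v f + v h) \<and>
     (\<forall>c f. smooth_fun A f \<longrightarrow> v (c *\<^sub>R f) = c * v f) \<and>
     (\<forall>f h. smooth_fun A f \<longrightarrow> smooth_fun A h \<longrightarrow> v (f * h) = f p * v h + h p * v f) \<and>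
     (\<forall>f. \<not> smooth_fun A f \<longrightarrow> v f = 0)}"

definition deriv_along :: "'a field \<Rightarrow> ('a \<Rightarrow> real) \<Rightarrow> ('a \<Rightarrow> real)"
  where "deriv_along X f = (\<lambda>p. X p f)"

definition smooth_field ::
    "('a, 'e::euclidean_space) chart set \<Rightarrow> 'a field \<Rightarrow> bool"
  where "smooth_field A X \<longleftrightarrow>
     (\<forall>p. X p \<in> tangent_space A p) \<and>
     (\<forall>f. smooth_fun A f \<longrightarrow> smooth_fun A (deriv_along X f))"

definition fmult :: "('a \<Rightarrow> real) \<Rightarrow> 'a field \<Rightarrow> 'a field"
  where "fmult f X = (\<lambda>p. f p *\<^sub>R X p)"

definition lie_bracket :: "'a field \<Rightarrow> 'a field \<Rightarrow> 'a field"
  where "lie_bracket X Y = (\<lambda>p f. X p (deriv_along Y f) - Y p (deriv_along X f))"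

section \<open>Tensor fields\<close>

type_synonym 'a endo_field = "'a \<Rightarrow> 'a tangent \<Rightarrow> 'a tangent"
type_synonym 'a form_field = "'a \<Rightarrow> 'a tangent \<Rightarrow> 'a tangent \<Rightarrow> real"

definition endo_app :: "'a endo_field \<Rightarrow> 'a field \<Rightarrow> 'a field"
  where "endo_app P X = (\<lambda>p. P p (X p))"

definition form_app :: "'a form_field \<Rightarrow> 'a field \<Rightarrow> 'a field \<Rightarrow> ('a \<Rightarrow> real)"
  where "form_app g X Y = (\<lambda>p. g p (X p) (Y p))"

definition tensor_field_11 ::
    "('a, 'e::euclidean_space) chart set \<Rightarrow> 'a endo_field \<Rightarrow> bool"
  where "tensor_field_11 A P \<longleftrightarrow>
     (\<forall>p. \<forall>v\<in>tangent_space A p. P p v \<in> tangent_space A p) \<and>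
     (\<forall>p. \<forall>v\<in>tangent_space A p. \<forall>w\<in>tangent_space A p. P p (v + w) = P p v + P p w) \<and>
     (\<forall>p c. \<forall>v\<in>tangent_space A p. P p (c *\<^sub>R v) = c *\<^sub>R P p v) \<and>
     (\<forall>X. smooth_field A X \<longrightarrow> smooth_field A (endo_app P X))"

definition riemannian_metric ::
    "('a, 'e::euclidean_space) chart set \<Rightarrow> 'a form_field \<Rightarrow> bool"
  where "riemannian_metric A g \<longleftrightarrow>
     (\<forall>p. \<forall>u\<in>tangent_space A p. \<forall>v\<in>tangent_space A p. \<forall>w\<in>tangent_space A p.
        g p (u + v) w = g p u w + g p v w) \<and>
     (\<forall>p c. \<forall>v\<in>tangent_space A p. \<forall>w\<in>tangent_space A p. g p (c *\<^sub>R v) w = c * g p v w) \<and>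
     (\<forall>p. \<forall>v\<in>tangent_space A p. \<forall>w\<in>tangent_space A p. g p v w = g p w v) \<and>
     (\<forall>p. \<forall>v\<in>tangent_space A p. v \<noteq> 0 \<longrightarrow> g p v v > 0) \<and>
     (\<forall>X Y. smooth_field A X \<longrightarrow> smooth_field A Y \<longrightarrow> smooth_fun A (form_app g X Y))"

text \<open>Trace of a linear map on a finite-dimensional subspace \<open>V\<close>; the value does not depend
  on the basis chosen.\<close>

definition trace_on :: "'v::real_vector set \<Rightarrow> ('v \<Rightarrow> 'v) \<Rightarrow> real"
  where "trace_on V T =
    (let B = (SOME B. independent B \<and> span B = V) in \<Sum>b\<in>B. representation B (T b) b)"

section \<open>The Levi-Civita connection and curvature\<close>

text \<open>A connection is only constrained on smooth vector fields. The conditions below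
  characterise the Levi-Civita connection of \<open>g\<close> uniquely there.\<close>

definition affine_connection ::
    "('a, 'e::euclidean_space) chart set \<Rightarrow> ('a field \<Rightarrow> 'a field \<Rightarrow> 'a field) \<Rightarrow> bool"
  where "affine_connection A nabla \<longleftrightarrow>
     (\<forall>X Y. smooth_field A X \<longrightarrow> smooth_field A Y \<longrightarrow> smooth_field A (nabla X Y)) \<and>
     (\<forall>X Y Z. smooth_field A X \<longrightarrow> smooth_field A Y \<longrightarrow> smooth_field A Z \<longrightarrow>
        nabla (X + Y) Z = nabla X Z + nabla Y Z) \<and>
     (\<forall>X Y Z. smooth_field A X \<longrightarrow> smooth_field A Y \<longrightarrow> smooth_field A Z \<longrightarrow>
        nabla X (Y + Z) = nabla X Y + nabla X Z) \<and>
     (\<forall>f X Y. smooth_fun A f \<longrightarrow> smooth_field A X \<longrightarrow> smooth_field A Y \<longrightarrow>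
        nabla (fmult f X) Y = fmult f (nabla X Y)) \<and>
     (\<forall>f X Y. smooth_fun A f \<longrightarrow> smooth_field A X \<longrightarrow> smooth_field A Y \<longrightarrow>
        nabla X (fmult f Y) = fmult (deriv_along X f) Y + fmult f (nabla X Y))"

definition levi_civita ::
    "('a, 'e::euclidean_space) chart set \<Rightarrow> 'a form_field \<Rightarrow>
     ('a field \<Rightarrow> 'a field \<Rightarrow> 'a field) \<Rightarrow> bool"
  where "levi_civita A g nabla \<longleftrightarrow> affine_connection A nabla \<and>
     (\<forall>X Y. smooth_field A X \<longrightarrow> smooth_field A Y \<longrightarrow>
        nabla X Y - nabla Y X = lie_bracket X Y) \<and>
     (\<forall>X Y Z. smooth_field A X \<longrightarrow> smooth_field A Y \<longrightarrow> smooth_field A Z \<longrightarrow>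
        deriv_along X (form_app g Y Z) = form_app g (nabla X Y) Z + form_app g Y (nabla X Z))"

definition nabla_endo ::
    "('a field \<Rightarrow> 'a field \<Rightarrow> 'a field) \<Rightarrow> 'a endo_field \<Rightarrow> 'a field \<Rightarrow> 'a field \<Rightarrow> 'a field"
  where "nabla_endo nabla P X Y = nabla X (endo_app P Y) - endo_app P (nabla X Y)"

definition curvature ::
    "('a field \<Rightarrow> 'a field \<Rightarrow> 'a field) \<Rightarrow> 'a field \<Rightarrow> 'a field \<Rightarrow> 'a field \<Rightarrow> 'a field"
  where "curvature nabla X Y Z =
     nabla X (nabla Y Z) - nabla Y (nabla X Z) - nabla (lie_bracket X Y) Z"

definition curvature4 ::
    "'a form_field \<Rightarrow> ('a field \<Rightarrow> 'a field \<Rightarrow> 'a field) \<Rightarrow>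
     'a field \<Rightarrow> 'a field \<Rightarrow> 'a field \<Rightarrow> 'a field \<Rightarrow> ('a \<Rightarrow> real)"
  where "curvature4 g nabla X Y Z W = form_app g (curvature nabla X Y Z) W"

section \<open>Riemannian almost product manifolds and the class W3\<close>

definition cyclic_sum :: "('b \<Rightarrow> 'b \<Rightarrow> 'b \<Rightarrow> 'c::ab_group_add) \<Rightarrow> 'b \<Rightarrow> 'b \<Rightarrow> 'b \<Rightarrow> 'c"
  where "cyclic_sum T x y z = T x y z + T y z x + T z x y"

definition riemannian_almost_product ::
    "('a::{t2_space,second_countable_topology}, 'e::euclidean_space) chart set \<Rightarrow>
     'a endo_field \<Rightarrow> 'a form_field \<Rightarrow> bool"
  where "riemannian_almost_product A P g \<longleftrightarrow>
     smooth_manifold A \<and> tensor_field_11 A P \<and> riemannian_metric A g \<and>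
     (\<forall>x. smooth_field A x \<longrightarrow> endo_app P (endo_app P x) = x) \<and>
     (\<forall>x y. smooth_field A x \<longrightarrow> smooth_field A y \<longrightarrow>
        form_app g (endo_app P x) (endo_app P y) = form_app g x y) \<and>
     (\<forall>p. trace_on (tangent_space A p) (P p) = 0)"

definition F_tensor ::
    "'a endo_field \<Rightarrow> 'a form_field \<Rightarrow> ('a field \<Rightarrow> 'a field \<Rightarrow> 'a field) \<Rightarrow>
     'a field \<Rightarrow> 'a field \<Rightarrow> 'a field \<Rightarrow> ('a \<Rightarrow> real)"
  where "F_tensor P g nabla x y z = form_app g (nabla_endo nabla P x y) z"

text \<open>Here \<open>nabla\<close> is meant to be the Levi-Civita connection of \<open>g\<close>.\<close>

definition riemannian_W3 ::
    "('a::{t2_space,second_countable_topology}, 'e::euclidean_space) chart set \<Rightarrow>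
     'a endo_field \<Rightarrow> 'a form_field \<Rightarrow> ('a field \<Rightarrow> 'a field \<Rightarrow> 'a field) \<Rightarrow> bool"
  where "riemannian_W3 A P g nabla \<longleftrightarrow>
     riemannian_almost_product A P g \<and>
     (\<forall>x y z. smooth_field A x \<longrightarrow> smooth_field A y \<longrightarrow> smooth_field A z \<longrightarrow>
        cyclic_sum (F_tensor P g nabla) x y z = 0)"

end

theory Submission
  imports Defs
begin

text \<open>Let \<open>G(a;b,c,d) = (\<nabla>\<^sub>a F)(b,c,d)\<close>. It is symmetric in \<open>c,d\<close>, its cyclic sum over
  \<open>b,c,d\<close> vanishes, and \<open>P\<close> can be moved from \<open>c\<close> to \<open>d\<close> up to a sign and terms quadratic in
  \<open>\<nabla>P\<close>. The Ricci identity turns the left-hand side \<open>L\<close> into a sum of values of \<open>G\<close>. These rules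
  reduce it to quadratic terms plus the cyclic sum of \<open>G(Px;w,y,z) - G(x;Pw,y,z)\<close>. Applying the
  Ricci identity once more to the latter and using the pair symmetry of \<open>R\<close> gives \<open>- L\<close> plus
  quadratic terms, so \<open>2 L\<close> is quadratic in \<open>\<nabla>P\<close>, and it is twice the right-hand side.\<close>

section \<open>Smoothness of sums and differences\<close>

lemma has_derivative_cong_open:
  assumes "open S" "x \<in> S" "\<And>y. y \<in> S \<Longrightarrow> f y = h y"
  shows "(f has_derivative D) (at x) \<longleftrightarrow> (h has_derivative D) (at x)"
  using assms has_derivative_transform_within_open[of f D x UNIV S h]
    has_derivative_transform_within_open[of h D x UNIV S f] by auto

text \<open>Derivatives on an open set are local. Formulas for derivatives of sums and negatives,
  valid only on \<open>S\<close>, can therefore be substituted inside the recursion of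
  \<open>Ck_on\<close>.\<close>

lemma Ck_on_cong:
  assumes "open S" "\<And>x. x \<in> S \<Longrightarrow> f x = h x"
  shows "Ck_on k f S \<longleftrightarrow> Ck_on k h S"
  using assms
proof (induction k arbitrary: f h)
  case 0
  then show ?case by (simp cong: continuous_on_cong)
next
  case (Suc k)
  \<comment> \<open>The same \<open>D\<close> qualify for both maps, so the choice operator behind
    \<open>frechet_derivative\<close> selects the same one.\<close>
  have *: "(f has_derivative D) (at x) \<longleftrightarrow> (h has_derivative D) (at x)" if "x \<in> S" for x D
    using has_derivative_cong_open[OF Suc.prems(1) that Suc.prems(2)] by simp
  have "Ck_on k (\<lambda>x. frechet_derivative f (at x) v) S \<longleftrightarrow>
      Ck_on k (\<lambda>x. frechet_derivative h (at x) v) S" for v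
    using Suc.prems(1) by (intro Suc.IH) (simp_all add: frechet_derivative_def *)
  then show ?case by (simp add: differentiable_def *)
qed

lemma Ck_on_add:
  assumes "open S" "Ck_on k f S" "Ck_on k h S"
  shows "Ck_on k (\<lambda>x. f x + h x) S"
  using assms
proof (induction k arbitrary: f h)
  case 0
  then show ?case by (simp add: continuous_on_add)
next
  case (Suc k)
  have "Ck_on k (\<lambda>x. frechet_derivative (\<lambda>x. f x + h x) (at x) v) S" for v
  proof -
    have "frechet_derivative (\<lambda>x. f x + h x) (at x)
        = (\<lambda>v. frechet_derivative f (at x) v + frechet_derivative h (at x) v)" if "x \<in> S" for x
      using Suc.prems that
      by (intro frechet_derivative_at[symmetric] has_derivative_add)
        (simp_all add: frechet_derivative_works)
    moreover have "Ck_on k (\<lambda>x. frechet_derivative f (at x) v + frechet_derivative h (at x) v) S"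
      using Suc by simp
    ultimately show ?thesis
      using Suc.prems by (subst Ck_on_cong) auto
  qed
  with Suc.prems show ?case by simp
qed

lemma Ck_on_minus:
  assumes "open S" "Ck_on k f S"
  shows "Ck_on k (\<lambda>x. - f x) S"
  using assms
proof (induction k arbitrary: f)
  case 0
  then show ?case by (simp add: continuous_on_minus)
next
  case (Suc k)
  have "Ck_on k (\<lambda>x. frechet_derivative (\<lambda>x. - f x) (at x) v) S" for v
  proof -
    have "frechet_derivative (\<lambda>x. - f x) (at x) = (\<lambda>v. - frechet_derivative f (at x) v)"
      if "x \<in> S" for x
      using Suc.prems that
      by (intro frechet_derivative_at[symmetric] has_derivative_minus)
        (simp add: frechet_derivative_works)
    moreover have "Ck_on k (\<lambda>x. - frechet_derivative f (at x) v) S"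
      using Suc by simp
    ultimately show ?thesis
      using Suc.prems by (subst Ck_on_cong) auto
  qed
  with Suc.prems show ?case by simp
qed

section \<open>Smooth functions, derivations and vector fields\<close>

context smooth_manifold
begin

lemma smooth_fun_add [simp]:
  assumes "smooth_fun A f" "smooth_fun A h"
  shows "smooth_fun A (f + h)"
proof -
  have "Ck_on k (\<lambda>u. f (chart_inv c u) + h (chart_inv c u)) (snd c ` fst c)" if "c \<in> A" for c k
    using assms chart_open[OF that] that
    by (intro Ck_on_add) (auto simp: smooth_fun_def smooth_on_def o_def)
  then show ?thesis
    by (simp add: smooth_fun_def smooth_on_def o_def)
qed

lemma smooth_fun_minus [simp]:
  assumes "smooth_fun A f"
  shows "smooth_fun A (- f)"
proof -
  have "Ck_on k (\<lambda>u. - f (chart_inv c u)) (snd c ` fst c)" if "c \<in> A" for c k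
    using assms chart_open[OF that] that
    by (intro Ck_on_minus) (auto simp: smooth_fun_def smooth_on_def o_def)
  then show ?thesis
    by (simp add: smooth_fun_def smooth_on_def o_def)
qed

lemma smooth_fun_diff [simp]:
  assumes "smooth_fun A f" "smooth_fun A h"
  shows "smooth_fun A (f - h)"
  using smooth_fun_add[of f "- h"] assms by simp

lemma tangent_add:
  assumes "v \<in> tangent_space A p" "smooth_fun A f" "smooth_fun A h"
  shows "v (f + h) = v f + v h"
  using assms by (simp add: tangent_space_def)

lemma tangent_diff:
  assumes "v \<in> tangent_space A p" "smooth_fun A f" "smooth_fun A h"
  shows "v (f - h) = v f - v h"
  using tangent_add[of v p "f - h" h] assms by simp

lemma tangent_zero:
  assumes "v \<in> tangent_space A p"
  shows "v 0 = 0"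
  \<comment> \<open>If \<open>0\<close> is smooth, apply additivity to \<open>0 + 0\<close>;
    otherwise \<open>v 0\<close> is the default value 0.\<close>
  using assms tangent_add[of v p 0 0] by (cases "smooth_fun A 0") (auto simp: tangent_space_def)

lemma tangent_not_smooth:
  assumes "v \<in> tangent_space A p" "\<not> smooth_fun A f"
  shows "v f = 0"
  using assms by (simp add: tangent_space_def)

lemma tangent_space_add:
  assumes "u \<in> tangent_space A p" "v \<in> tangent_space A p"
  shows "u + v \<in> tangent_space A p"
  using assms by (simp add: tangent_space_def algebra_simps)

lemma tangent_space_diff:
  assumes "u \<in> tangent_space A p" "v \<in> tangent_space A p"
  shows "u - v \<in> tangent_space A p"
  using assms by (simp add: tangent_space_def algebra_simps)

lemma smooth_field_tangent:
  assumes "smooth_field A X"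
  shows "X p \<in> tangent_space A p"
  using assms by (simp add: smooth_field_def)

lemma deriv_along_smooth [simp]:
  assumes "smooth_field A X" "smooth_fun A f"
  shows "smooth_fun A (deriv_along X f)"
  using assms by (simp add: smooth_field_def)

lemma deriv_along_add_left: "deriv_along (X + Y) f = deriv_along X f + deriv_along Y f"
  by (simp add: deriv_along_def fun_eq_iff)

lemma deriv_along_diff_left: "deriv_along (X - Y) f = deriv_along X f - deriv_along Y f"
  by (simp add: deriv_along_def fun_eq_iff)

lemma deriv_along_zero_left: "deriv_along 0 f = 0"
  by (simp add: deriv_along_def zero_fun_def)

lemma deriv_along_add:
  assumes "smooth_field A X" "smooth_fun A f" "smooth_fun A h"
  shows "deriv_along X (f + h) = deriv_along X f + deriv_along X h"
  using assms by (simp add: deriv_along_def fun_eq_iff tangent_add[OF smooth_field_tangent])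

lemma deriv_along_diff:
  assumes "smooth_field A X" "smooth_fun A f" "smooth_fun A h"
  shows "deriv_along X (f - h) = deriv_along X f - deriv_along X h"
  using assms by (simp add: deriv_along_def fun_eq_iff tangent_diff[OF smooth_field_tangent])

lemma deriv_along_zero:
  assumes "smooth_field A X"
  shows "deriv_along X 0 = 0"
  using assms by (simp add: deriv_along_def fun_eq_iff tangent_zero[OF smooth_field_tangent])

lemma deriv_along_minus:
  assumes "smooth_field A X" "smooth_fun A f"
  shows "deriv_along X (- f) = - deriv_along X f"
  using deriv_along_add[of X "- f" f] deriv_along_zero[of X] assms
  by (simp add: eq_neg_iff_add_eq_0)

lemma deriv_along_not_smooth:
  assumes "smooth_field A X" "\<not> smooth_fun A f"
  shows "deriv_along X f = 0"
  using assms by (simp add: deriv_along_def fun_eq_iff tangent_not_smooth[OF smooth_field_tangent])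

lemma smooth_field_add [simp]:
  assumes "smooth_field A X" "smooth_field A Y"
  shows "smooth_field A (X + Y)"
  using assms by (simp add: smooth_field_def tangent_space_add deriv_along_add_left)

lemma smooth_field_diff [simp]:
  assumes "smooth_field A X" "smooth_field A Y"
  shows "smooth_field A (X - Y)"
  using assms by (simp add: smooth_field_def tangent_space_diff deriv_along_diff_left)

lemma deriv_along_lie_bracket:
  "deriv_along (lie_bracket X Y) f
     = deriv_along X (deriv_along Y f) - deriv_along Y (deriv_along X f)"
  by (simp add: deriv_along_def lie_bracket_def fun_eq_iff)

text \<open>Fields are total in \<open>f\<close>, so equality has to be tested on non-smooth
  \<open>f\<close> as well; for smooth fields the default value 0 decides there.\<close>

lemma field_eqI:
  assumes "\<And>f. deriv_along X f = deriv_along Y f"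
  shows "X = Y"
  using assms by (auto simp: deriv_along_def fun_eq_iff)

text \<open>On smooth \<open>f\<close> the nested commutators expand into twelve third-order terms
  that cancel in pairs.\<close>

lemma lie_bracket_jacobi:
  assumes "smooth_field A X" "smooth_field A Y" "smooth_field A Z"
  shows "lie_bracket X (lie_bracket Y Z) + lie_bracket Y (lie_bracket Z X)
           + lie_bracket Z (lie_bracket X Y) = 0"
proof (rule field_eqI)
  fix f
  show "deriv_along (lie_bracket X (lie_bracket Y Z) + lie_bracket Y (lie_bracket Z X)
           + lie_bracket Z (lie_bracket X Y)) f = deriv_along 0 f"
  proof (cases "smooth_fun A f")
    case True
    have *: "deriv_along (lie_bracket U (lie_bracket V W)) f
        = (deriv_along U (deriv_along V (deriv_along W f))
            - deriv_along U (deriv_along W (deriv_along V f)))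
          - (deriv_along V (deriv_along W (deriv_along U f))
            - deriv_along W (deriv_along V (deriv_along U f)))"
      if "smooth_field A U" "smooth_field A V" "smooth_field A W" for U V W
      using that True by (simp only: deriv_along_lie_bracket deriv_along_diff deriv_along_smooth)
    show ?thesis
      unfolding deriv_along_add_left deriv_along_zero_left *[OF assms] *[OF assms(2,3,1)]
        *[OF assms(3,1,2)] by (rule ext) simp
  next
    case False
    then have 0: "deriv_along U f = 0" if "smooth_field A U" for U
      using that by (simp only: deriv_along_not_smooth not_False_eq_True)
    have *: "deriv_along (lie_bracket U (lie_bracket V W)) f = 0"
      if "smooth_field A U" "smooth_field A V" "smooth_field A W" for U V W
      using that by (simp only: deriv_along_lie_bracket 0 deriv_along_zero diff_self)
    show ?thesis
      unfolding deriv_along_add_left deriv_along_zero_left *[OF assms] *[OF assms(2,3,1)]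
        *[OF assms(3,1,2)] by simp
  qed
qed

end

section \<open>Symmetries of the curvature of a Levi-Civita connection\<close>

locale riemannian_manifold = smooth_manifold A
  for A :: "('a::{t2_space,second_countable_topology}, 'e::euclidean_space) chart set" +
  fixes g :: "'a form_field" and nabla :: "'a field \<Rightarrow> 'a field \<Rightarrow> 'a field"
  assumes metric: "riemannian_metric A g"
    and levi_civita: "levi_civita A g nabla"
begin

section \<open>Linearity of the metric and of the connection\<close>

lemma form_app_smooth [simp]:
  assumes "smooth_field A X" "smooth_field A Y"
  shows "smooth_fun A (form_app g X Y)"
  using assms metric by (simp add: riemannian_metric_def)

lemma form_app_commute:
  assumes "smooth_field A X" "smooth_field A Y"
  shows "form_app g X Y = form_app g Y X"
  using assms metric smooth_field_tangent
  by (auto simp: riemannian_metric_def form_app_def)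

lemma form_app_add_left:
  assumes "smooth_field A X" "smooth_field A Y" "smooth_field A Z"
  shows "form_app g (X + Y) Z = form_app g X Z + form_app g Y Z"
  using assms metric smooth_field_tangent
  by (auto simp: riemannian_metric_def form_app_def fun_eq_iff)

lemma form_app_diff_left:
  assumes "smooth_field A X" "smooth_field A Y" "smooth_field A Z"
  shows "form_app g (X - Y) Z = form_app g X Z - form_app g Y Z"
  using form_app_add_left[of "X - Y" Y Z] assms by simp

lemma form_app_add_right:
  assumes "smooth_field A X" "smooth_field A Y" "smooth_field A Z"
  shows "form_app g Z (X + Y) = form_app g Z X + form_app g Z Y"
  using assms by (simp add: form_app_commute[of Z] form_app_add_left)

lemma form_app_diff_right:
  assumes "smooth_field A X" "smooth_field A Y" "smooth_field A Z"
  shows "form_app g Z (X - Y) = form_app g Z X - form_app g Z Y"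
  using assms by (simp add: form_app_commute[of Z] form_app_diff_left)

lemma form_app_zero_left:
  assumes "smooth_field A Z"
  shows "form_app g 0 Z = 0"
  using form_app_diff_left[of Z Z Z] assms by simp

lemma nabla_smooth [simp]:
  assumes "smooth_field A X" "smooth_field A Y"
  shows "smooth_field A (nabla X Y)"
  using assms levi_civita by (simp add: levi_civita_def affine_connection_def)

lemma nabla_add_left:
  assumes "smooth_field A X" "smooth_field A Y" "smooth_field A Z"
  shows "nabla (X + Y) Z = nabla X Z + nabla Y Z"
  using assms levi_civita by (simp add: levi_civita_def affine_connection_def)

lemma nabla_diff_left:
  assumes "smooth_field A X" "smooth_field A Y" "smooth_field A Z"
  shows "nabla (X - Y) Z = nabla X Z - nabla Y Z"
  using nabla_add_left[of "X - Y" Y Z] assms by simp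

lemma nabla_add_right:
  assumes "smooth_field A X" "smooth_field A Y" "smooth_field A Z"
  shows "nabla Z (X + Y) = nabla Z X + nabla Z Y"
  using assms levi_civita by (simp add: levi_civita_def affine_connection_def)

lemma nabla_diff_right:
  assumes "smooth_field A X" "smooth_field A Y" "smooth_field A Z"
  shows "nabla Z (X - Y) = nabla Z X - nabla Z Y"
  using nabla_add_right[of "X - Y" Y Z] assms by simp

lemma lie_bracket_eq:
  assumes "smooth_field A X" "smooth_field A Y"
  shows "lie_bracket X Y = nabla X Y - nabla Y X"
  using assms levi_civita by (simp add: levi_civita_def)

lemma deriv_along_form_app:
  assumes "smooth_field A X" "smooth_field A Y" "smooth_field A Z"
  shows "deriv_along X (form_app g Y Z) = form_app g (nabla X Y) Z + form_app g Y (nabla X Z)"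
  using assms levi_civita by (simp add: levi_civita_def)

text \<open>Vanishing torsion removes the bracket: every term becomes an iterated
  \<open>nabla\<close>, so smoothness follows from \<open>nabla_smooth\<close>.\<close>

lemma curvature_eq:
  assumes "smooth_field A X" "smooth_field A Y" "smooth_field A Z"
  shows "curvature nabla X Y Z = nabla X (nabla Y Z) - nabla Y (nabla X Z)
           - nabla (nabla X Y) Z + nabla (nabla Y X) Z"
  using assms by (simp add: curvature_def lie_bracket_eq nabla_diff_left)

lemma curvature_smooth [simp]:
  assumes "smooth_field A X" "smooth_field A Y" "smooth_field A Z"
  shows "smooth_field A (curvature nabla X Y Z)"
  using assms by (simp add: curvature_eq)

text \<open>Without torsion the left-hand side collapses to the cyclic sum of
  \<open>lie_bracket X (lie_bracket Y Z)\<close>, and the Jacobi identity applies.\<close>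

lemma curvature_bianchi:
  assumes "smooth_field A X" "smooth_field A Y" "smooth_field A Z"
  shows "curvature nabla X Y Z + curvature nabla Y Z X + curvature nabla Z X Y = 0"
  using lie_bracket_jacobi[OF assms] assms
  by (simp add: curvature_eq lie_bracket_eq nabla_diff_left nabla_diff_right algebra_simps)

lemma curvature4_skew_left:
  assumes "smooth_field A X" "smooth_field A Y" "smooth_field A Z" "smooth_field A W"
  shows "curvature4 g nabla X Y Z W = - curvature4 g nabla Y X Z W"
  using assms
  by (simp add: curvature4_def curvature_eq form_app_add_left form_app_diff_left)

text \<open>The bracket of \<open>X\<close> and \<open>Y\<close> acts on g(Z,W) as a commutator.
  Expanding both sides by metric compatibility, the mixed products of first derivatives cancel and
  the two curvature terms remain.\<close>

lemma curvature4_skew_right: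
  assumes "smooth_field A X" "smooth_field A Y" "smooth_field A Z" "smooth_field A W"
  shows "curvature4 g nabla X Y Z W = - curvature4 g nabla X Y W Z"
proof -
  have "deriv_along (nabla X Y - nabla Y X) (form_app g Z W)
      = deriv_along X (deriv_along Y (form_app g Z W))
        - deriv_along Y (deriv_along X (form_app g Z W))"
    using assms by (simp add: deriv_along_lie_bracket flip: lie_bracket_eq)
  then have "curvature4 g nabla X Y Z W + curvature4 g nabla X Y W Z = 0"
    using assms
    by (simp add: deriv_along_diff_left deriv_along_form_app deriv_along_add curvature4_def
        curvature_eq form_app_add_left form_app_diff_left form_app_add_right
        form_app_diff_right form_app_commute algebra_simps)
  then show ?thesis by (simp add: eq_neg_iff_add_eq_0)
qed

lemma curvature4_bianchi:
  assumes "smooth_field A X" "smooth_field A Y" "smooth_field A Z" "smooth_field A W"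
  shows "curvature4 g nabla X Y Z W + curvature4 g nabla Y Z X W + curvature4 g nabla Z X Y W = 0"
proof -
  have "curvature4 g nabla X Y Z W + curvature4 g nabla Y Z X W + curvature4 g nabla Z X Y W
      = form_app g (curvature nabla X Y Z + curvature nabla Y Z X + curvature nabla Z X Y) W"
    using assms by (simp add: curvature4_def form_app_add_left)
  then show ?thesis
    using assms by (simp add: curvature_bianchi form_app_zero_left)
qed

lemma curvature4_pair_symmetry:
  assumes X: "smooth_field A X" and Y: "smooth_field A Y"
    and Z: "smooth_field A Z" and W: "smooth_field A W"
  shows "curvature4 g nabla X Y Z W = curvature4 g nabla Z W X Y"
proof
  fix p
  \<comment> \<open>Evaluation at \<open>p\<close> turns identities between functions into real
    linear equations.\<close>
  let ?R = "\<lambda>X Y Z W. curvature4 g nabla X Y Z W p"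
  have b: "?R X Y Z W + ?R Y Z X W + ?R Z X Y W = 0"
    and l: "?R X Y Z W = - ?R Y X Z W" and r: "?R X Y Z W = - ?R X Y W Z"
    if "smooth_field A X" "smooth_field A Y" "smooth_field A Z" "smooth_field A W" for X Y Z W
    using fun_cong[OF curvature4_bianchi[OF that], of p]
      fun_cong[OF curvature4_skew_left[OF that], of p]
      fun_cong[OF curvature4_skew_right[OF that], of p] by simp_all
  show "?R X Y Z W = ?R Z W X Y"
    \<comment> \<open>The four Bianchi sums, one for each field in the last slot; the
      skew-symmetries identify their terms up to sign.\<close>
    using b[OF X Y Z W] b[OF Y Z W X] b[OF Z W X Y] b[OF W X Y Z]
      l[OF Z X Y W] r[OF Y Z W X] r[OF Z W Y X] l[OF W Y Z X] r[OF Y W Z X]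
      l[OF W X Z Y] r[OF X W Z Y] r[OF X Z W Y] l[OF W X Y Z] r[OF X Y W Z]
    by linarith
qed

end

section \<open>The covariant derivative of the fundamental tensor\<close>

locale W3_manifold = riemannian_manifold A g nabla
  for A :: "('a::{t2_space,second_countable_topology}, 'e::euclidean_space) chart set"
    and g :: "'a form_field" and nabla :: "'a field \<Rightarrow> 'a field \<Rightarrow> 'a field" +
  fixes P :: "'a endo_field"
  assumes W3: "riemannian_W3 A P g nabla"
begin

section \<open>Algebra of \<open>P\<close> and symmetries of \<open>F\<close>\<close>

abbreviation P' :: "'a field \<Rightarrow> 'a field"
  where "P' \<equiv> endo_app P"

abbreviation D :: "'a field \<Rightarrow> 'a field \<Rightarrow> 'a field"
  where "D \<equiv> nabla_endo nabla P"

abbreviation F :: "'a field \<Rightarrow> 'a field \<Rightarrow> 'a field \<Rightarrow> 'a \<Rightarrow> real"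
  where "F \<equiv> F_tensor P g nabla"

lemma tensor: "tensor_field_11 A P"
  using W3 by (simp add: riemannian_W3_def riemannian_almost_product_def)

lemma P_smooth [simp]:
  assumes "smooth_field A X"
  shows "smooth_field A (P' X)"
  using assms tensor by (simp add: tensor_field_11_def)

lemma P_add:
  assumes "smooth_field A X" "smooth_field A Y"
  shows "P' (X + Y) = P' X + P' Y"
proof
  show "P' (X + Y) p = (P' X + P' Y) p" for p
    using assms[THEN smooth_field_tangent, of p] tensor
    by (simp add: tensor_field_11_def endo_app_def)
qed

lemma P_diff:
  assumes "smooth_field A X" "smooth_field A Y"
  shows "P' (X - Y) = P' X - P' Y"
  using P_add[of "X - Y" Y] assms by simp

lemma P_P [simp]:
  assumes "smooth_field A X"
  shows "P' (P' X) = X"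
  using assms W3 by (simp add: riemannian_W3_def riemannian_almost_product_def)

lemma form_app_P_P:
  assumes "smooth_field A X" "smooth_field A Y"
  shows "form_app g (P' X) (P' Y) = form_app g X Y"
  using assms W3 by (simp add: riemannian_W3_def riemannian_almost_product_def)

text \<open>An involutive isometry is self-adjoint.\<close>

lemma form_app_P_left:
  assumes "smooth_field A X" "smooth_field A Y"
  shows "form_app g (P' X) Y = form_app g X (P' Y)"
  using form_app_P_P[of X "P' Y"] assms by simp

lemma D_smooth [simp]:
  assumes "smooth_field A X" "smooth_field A Y"
  shows "smooth_field A (D X Y)"
  using assms by (simp add: nabla_endo_def)

lemma F_smooth [simp]:
  assumes "smooth_field A X" "smooth_field A Y" "smooth_field A Z"
  shows "smooth_fun A (F X Y Z)"
  using assms by (simp add: F_tensor_def)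

lemma F_eq:
  assumes "smooth_field A X" "smooth_field A Y" "smooth_field A Z"
  shows "F X Y Z = form_app g (nabla X (P' Y)) Z - form_app g (nabla X Y) (P' Z)"
  using assms by (simp add: F_tensor_def nabla_endo_def form_app_diff_left form_app_P_left)

text \<open>This is the self-adjointness of \<open>P\<close>, differentiated along
  \<open>X\<close>.\<close>

lemma F_commute:
  assumes "smooth_field A X" "smooth_field A Y" "smooth_field A Z"
  shows "F X Y Z = F X Z Y"
proof -
  have "deriv_along X (form_app g (P' Y) Z) = deriv_along X (form_app g Y (P' Z))"
    using assms by (simp add: form_app_P_left)
  then show ?thesis
    using assms by (simp add: deriv_along_form_app F_eq form_app_commute algebra_simps)
qed

text \<open>Differentiating P^2 = id shows that \<open>P\<close> anticommutes with its covariant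
  derivative; self-adjointness then moves it to the last slot.\<close>

lemma F_P:
  assumes "smooth_field A X" "smooth_field A Y" "smooth_field A Z"
  shows "F X (P' Y) Z = - F X Y (P' Z)"
  using assms by (simp add: F_eq)

lemma F_diff_mid:
  assumes "smooth_field A X" "smooth_field A Y" "smooth_field A Y'" "smooth_field A Z"
  shows "F X (Y - Y') Z = F X Y Z - F X Y' Z"
  using assms by (simp add: F_eq P_diff nabla_diff_right form_app_diff_left)

lemma F_cyclic:
  assumes "smooth_field A X" "smooth_field A Y" "smooth_field A Z"
  shows "F X Y Z + F Y Z X + F Z X Y = 0"
  using assms W3 by (simp add: riemannian_W3_def cyclic_sum_def)

section \<open>The covariant derivative of \<open>F\<close>, called \<open>G\<close> in the
  overview\<close>

definition nabla_F :: "'a field \<Rightarrow> 'a field \<Rightarrow> 'a field \<Rightarrow> 'a field \<Rightarrow> 'a \<Rightarrow> real"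
  where "nabla_F a b c d =
    deriv_along a (F b c d) - F (nabla a b) c d - F b (nabla a c) d - F b c (nabla a d)"

lemma nabla_F_commute:
  assumes "smooth_field A a" "smooth_field A b" "smooth_field A c" "smooth_field A d"
  shows "nabla_F a b c d = nabla_F a b d c"
  using assms by (simp add: nabla_F_def F_commute[of _ c] F_commute[of _ "nabla a c"])

text \<open>Differentiate the W3 condition; the correction terms are three more instances of it,
  each with one argument replaced by its covariant derivative.\<close>

lemma nabla_F_cyclic:
  assumes a: "smooth_field A a" and b: "smooth_field A b"
    and c: "smooth_field A c" and d: "smooth_field A d"
  shows "nabla_F a b c d + nabla_F a c d b + nabla_F a d b c = 0"
proof
  fix p
  have "deriv_along a (F b c d + F c d b + F d b c) = 0"
    using assms by (simp add: F_cyclic deriv_along_zero)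
  then have "deriv_along a (F b c d) + deriv_along a (F c d b) + deriv_along a (F d b c) = 0"
    using assms by (simp add: deriv_along_add)
  from fun_cong[OF this, of p] fun_cong[OF F_cyclic[OF nabla_smooth[OF a b] c d], of p]
    fun_cong[OF F_cyclic[OF b nabla_smooth[OF a c] d], of p]
    fun_cong[OF F_cyclic[OF b c nabla_smooth[OF a d]], of p]
  show "(nabla_F a b c d + nabla_F a c d b + nabla_F a d b c) p = 0 p"
    by (simp add: nabla_F_def)
qed

text \<open>Differentiate \<open>F_P\<close>. Since \<open>nabla a (P' c)\<close> is
  \<open>D a c + P' (nabla a c)\<close>, and likewise for \<open>d\<close>, the \<open>D\<close>
  parts survive as quadratic terms and the rest cancels by \<open>F_P\<close>.\<close>

lemma nabla_F_P:
  assumes "smooth_field A a" "smooth_field A b" "smooth_field A c" "smooth_field A d"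
  shows "nabla_F a b (P' c) d + nabla_F a b c (P' d)
           = - form_app g (D b d) (D a c) - form_app g (D b c) (D a d)"
proof -
  have 1: "deriv_along a (F b (P' c) d) = - deriv_along a (F b c (P' d))"
    using assms by (simp add: F_P deriv_along_minus)
  \<comment> \<open>Symmetry of \<open>F\<close> turns F(b,d,\<open>D a c\<close>) into
    F(b,\<open>D a c\<close>,d), where \<open>D a c\<close> is then expanded.\<close>
  have 2: "form_app g (D b d) (D a c) = F b (nabla a (P' c)) d - F b (P' (nabla a c)) d"
    using assms F_commute[of b "D a c" d]
    by (simp add: F_diff_mid nabla_endo_def F_tensor_def[of P g nabla b d])
  have 3: "form_app g (D b c) (D a d) = F b c (nabla a (P' d)) - F b c (P' (nabla a d))"
    using assms by (simp add: F_tensor_def nabla_endo_def[of nabla P a] form_app_diff_right)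
  show ?thesis
    using assms by (simp add: nabla_F_def 1 2 3) (simp add: F_P)
qed

text \<open>Lowering an index commutes with \<open>nabla\<close>, so \<open>nabla_F\<close> is the
  second covariant derivative of \<open>P\<close> paired with \<open>d\<close>.\<close>

lemma nabla_F_eq:
  assumes "smooth_field A a" "smooth_field A b" "smooth_field A c" "smooth_field A d"
  shows "nabla_F a b c d = form_app g (nabla a (D b c) - D (nabla a b) c - D b (nabla a c)) d"
  using assms by (simp add: nabla_F_def F_tensor_def deriv_along_form_app form_app_diff_left)

text \<open>Antisymmetrizing the second covariant derivative of \<open>P\<close> gives the
  commutator of the curvature operator with \<open>P\<close>; self-adjointness shifts the outer
  \<open>P\<close> onto \<open>d\<close>.\<close>

lemma nabla_F_ricci:
  assumes "smooth_field A a" "smooth_field A b" "smooth_field A c" "smooth_field A d"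
  shows "nabla_F a b c d - nabla_F b a c d
           = curvature4 g nabla a b (P' c) d - curvature4 g nabla a b c (P' d)"
proof -
  have "(nabla a (D b c) - D (nabla a b) c - D b (nabla a c))
        - (nabla b (D a c) - D (nabla b a) c - D a (nabla b c))
      = curvature nabla a b (P' c) - P' (curvature nabla a b c)"
    using assms
    by (simp add: nabla_endo_def nabla_diff_right curvature_eq P_diff P_add algebra_simps)
  then have "form_app g ((nabla a (D b c) - D (nabla a b) c - D b (nabla a c))
        - (nabla b (D a c) - D (nabla b a) c - D a (nabla b c))) d
      = form_app g (curvature nabla a b (P' c) - P' (curvature nabla a b c)) d"
    by simp
  then show ?thesis
    using assms by (simp add: nabla_F_eq curvature4_def form_app_diff_left form_app_P_left)
qed

text \<open>The cyclic identity replaces each summand by two with \<open>P\<close> in one of the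
  last two slots. The six results, grouped by their second argument, form three pairs to which
  \<open>nabla_F_P\<close> applies.\<close>

lemma nabla_F_sum_P:
  assumes a: "smooth_field A a" and b: "smooth_field A b"
    and c: "smooth_field A c" and d: "smooth_field A d"
  shows "nabla_F a (P' b) c d + nabla_F a (P' c) b d + nabla_F a (P' d) b c
    = form_app g (D d c + D c d) (D a b) + form_app g (D d b + D b d) (D a c)
      + form_app g (D b c + D c b) (D a d)"
proof
  fix p
  let ?G = "\<lambda>a b c d. nabla_F a b c d p"
  have cyc: "?G a b c d + ?G a c d b + ?G a d b c = 0" and com: "?G a b c d = ?G a b d c"
    if "smooth_field A b" "smooth_field A c" "smooth_field A d" for b c d
    using fun_cong[OF nabla_F_cyclic[OF a that], of p]
      fun_cong[OF nabla_F_commute[OF a that], of p] by simp_all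
  have mv: "?G a b (P' c) d + ?G a b c (P' d)
      = - form_app g (D b d) (D a c) p - form_app g (D b c) (D a d) p"
    if "smooth_field A b" "smooth_field A c" "smooth_field A d" for b c d
    using fun_cong[OF nabla_F_P[OF a that], of p] by simp
  note P = b[THEN P_smooth] c[THEN P_smooth] d[THEN P_smooth]
  show "(nabla_F a (P' b) c d + nabla_F a (P' c) b d + nabla_F a (P' d) b c) p
    = (form_app g (D d c + D c d) (D a b) + form_app g (D d b + D b d) (D a c)
      + form_app g (D b c + D c b) (D a d)) p"
    using cyc[OF P(1) c d] cyc[OF P(2) b d] cyc[OF P(3) b c] mv[OF b c d] mv[OF c b d] mv[OF d b c]
      com[OF b d P(2)] com[OF c d P(1)] com[OF c P(3) b] com[OF d P(2) b]
    by (simp add: form_app_add_left assms)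
qed

section \<open>The curvature identity, evaluated at a point\<close>

lemma curvature4_cyclic:
  assumes x: "smooth_field A x" and y: "smooth_field A y"
    and z: "smooth_field A z" and w: "smooth_field A w"
  defines "R \<equiv> curvature4 g nabla"
  shows "cyclic_sum (\<lambda>x y z. R x (P' y) (P' z) w - R x (P' y) z (P' w)
                           + R (P' x) y z (P' w) - R (P' x) y (P' z) w) x y z
       = cyclic_sum (\<lambda>x y z. form_app g (D x y + D y x) (D z w + D w z)) x y z"
proof
  fix p
  let ?G = "\<lambda>a b c d. nabla_F a b c d p" and ?R = "\<lambda>a b c d. R a b c d p"
  let ?Q = "\<lambda>a b c d. form_app g (D a b + D b a) (D c d) p"
  let ?cyc = "\<lambda>T :: 'a field \<Rightarrow> 'a field \<Rightarrow> 'a field \<Rightarrow> real. T x y z + T y z x + T z x y"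
  let ?L = "?cyc (\<lambda>a b c. ?R a (P' b) (P' c) w - ?R a (P' b) c (P' w)
                   + ?R (P' a) b c (P' w) - ?R (P' a) b (P' c) w)"
  \<comment> \<open>\<open>?K\<close> collects the quadratic terms of \<open>nabla_F_sum_P\<close>
    with first argument \<open>x\<close>, \<open>y\<close> or \<open>z\<close>; \<open>?T\<close>
    those with first argument \<open>w\<close>.\<close>
  let ?K = "?cyc (\<lambda>a b c. ?Q w c a b + ?Q w b a c + ?Q b c a w)"
  let ?T = "?cyc (\<lambda>a b c. ?Q a b w c)"
  have twice: "2 * l = k + t" if "l = - l + t + k" for l k t :: real
    using that by simp
  note x' = P_smooth[OF x] and y' = P_smooth[OF y] and z' = P_smooth[OF z]
    and w' = P_smooth[OF w]
  have Q_commute: "?Q a b c d = ?Q b a c d" for a b c d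
    by (simp add: add.commute)
  have cyc: "?G a b c d + ?G a c d b + ?G a d b c = 0" and com: "?G a b c d = ?G a b d c"
    and ric: "?G a b c d - ?G b a c d = ?R a b (P' c) d - ?R a b c (P' d)"
    and pair: "?R a b c d = ?R c d a b"
    and sumP: "?G a (P' b) c d + ?G a (P' c) b d + ?G a (P' d) b c
      = ?Q d c a b + ?Q d b a c + ?Q b c a d"
    if "smooth_field A a" "smooth_field A b" "smooth_field A c" "smooth_field A d" for a b c d
    using fun_cong[OF nabla_F_cyclic[OF that], of p] fun_cong[OF nabla_F_commute[OF that], of p]
      fun_cong[OF nabla_F_ricci[OF that], of p] fun_cong[OF curvature4_pair_symmetry[OF that], of p]
      fun_cong[OF nabla_F_sum_P[OF that], of p]
    by (simp_all add: R_def)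
  have 1: "?L = ?cyc (\<lambda>a b c. ?G a (P' b) c w - ?G (P' b) a c w - ?G (P' a) b c w + ?G b (P' a) c w)"
    using ric[OF x y' z w] ric[OF y z' x w] ric[OF z x' y w]
      ric[OF x' y z w] ric[OF y' z x w] ric[OF z' x y w] by linarith
  \<comment> \<open>Grouped by first argument, the six terms form three pairs, each completed to a
    sum \<open>sumP\<close> by the term carrying \<open>P' w\<close>.\<close>
  have 2: "?cyc (\<lambda>a b c. ?G a (P' b) c w + ?G b (P' a) c w)
      = ?cyc (\<lambda>a b c. - ?G a (P' w) b c) + ?K"
    using sumP[OF x y z w] sumP[OF y z x w] sumP[OF z x y w] by linarith
  \<comment> \<open>Again three pairs, now with first argument \<open>P' x\<close>,
    \<open>P' y\<close> or \<open>P' z\<close>, completed by \<open>w\<close> to a vanishing cyclic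
    sum.\<close>
  have 3: "?cyc (\<lambda>a b c. ?G (P' b) a c w + ?G (P' a) b c w) = ?cyc (\<lambda>a b c. - ?G (P' a) w b c)"
    using cyc[OF x' w y z] cyc[OF y' w z x] cyc[OF z' w x y]
      com[OF x' z w y] com[OF y' x w z] com[OF z' y w x] by linarith
  \<comment> \<open>The Ricci identity brings \<open>w\<close> or \<open>P' w\<close> to the front;
    the terms led by \<open>P' w\<close> cancel by the cyclic identity in \<open>x\<close>,
    \<open>y\<close>, \<open>z\<close>.\<close>
  have 4: "?cyc (\<lambda>a b c. ?G (P' a) w b c - ?G a (P' w) b c)
      = ?cyc (\<lambda>a b c. ?R (P' a) w (P' b) c - ?R (P' a) w b (P' c)
          - ?R a (P' w) (P' b) c + ?R a (P' w) b (P' c)) + ?cyc (\<lambda>a b c. ?G w (P' a) b c)"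
    using ric[OF x' w y z] ric[OF y' w z x] ric[OF z' w x y]
      ric[OF x w' y z] ric[OF y w' z x] ric[OF z w' x y] cyc[OF w' x y z] by linarith
  \<comment> \<open>Pair symmetry puts \<open>w\<close> or \<open>P' w\<close> last; a cyclic
    relabelling then gives the terms of \<open>?L\<close> with opposite signs.\<close>
  have 5: "?cyc (\<lambda>a b c. ?R (P' a) w (P' b) c - ?R (P' a) w b (P' c)
          - ?R a (P' w) (P' b) c + ?R a (P' w) b (P' c)) = - ?L"
    using pair[OF x' w y' z] pair[OF x' w y z'] pair[OF x w' y' z] pair[OF x w' y z']
      pair[OF y' w z' x] pair[OF y' w z x'] pair[OF y w' z' x] pair[OF y w' z x']
      pair[OF z' w x' y] pair[OF z' w x y'] pair[OF z w' x' y] pair[OF z w' x y'] by linarith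
  have 6: "?cyc (\<lambda>a b c. ?G w (P' a) b c) = ?T"
    using sumP[OF w x y z] Q_commute[of z y w x] com[OF w y' x z] by linarith
  have "?L = ?cyc (\<lambda>a b c. ?G (P' a) w b c - ?G a (P' w) b c) + ?K"
    using 1 2 3 by linarith
  also have "\<dots> = - ?L + ?T + ?K"
    by (simp only: 4 5 6)
  finally have "2 * ?L = ?K + ?T"
    by (rule twice)
  \<comment> \<open>Up to cyclic relabelling, the first two summands of \<open>?K\<close> make up
    one copy of the right-hand side; its third summand and \<open>?T\<close> make up the
    other.\<close>
  also have "\<dots> = 2 * ?cyc (\<lambda>a b c. form_app g (D a b + D b a) (D c w + D w c) p)"
    by (simp add: assms form_app_add_left form_app_add_right form_app_commute)
  finally show "cyclic_sum (\<lambda>x y z. R x (P' y) (P' z) w - R x (P' y) z (P' w)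
                           + R (P' x) y z (P' w) - R (P' x) y (P' z) w) x y z p
       = cyclic_sum (\<lambda>x y z. form_app g (D x y + D y x) (D z w + D w z)) x y z p"
    by (simp add: cyclic_sum_def)
qed

end

theorem theorem2p1:
  fixes A :: "('a::{t2_space,second_countable_topology}, 'e::euclidean_space) chart set"
    and P :: "'a endo_field"
    and g :: "'a form_field"
    and nabla :: "'a field \<Rightarrow> 'a field \<Rightarrow> 'a field"
    and x y z w :: "'a field"
  defines "R \<equiv> curvature4 g nabla"
    and "P' \<equiv> endo_app P"
    and "D \<equiv> nabla_endo nabla P"
  assumes "levi_civita A g nabla"
    and "riemannian_W3 A P g nabla"
    and "smooth_field A x" "smooth_field A y" "smooth_field A z" "smooth_field A w"
  shows "cyclic_sum (\<lambda>x y z. R x (P' y) (P' z) w - R x (P' y) z (P' w)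
                           + R (P' x) y z (P' w) - R (P' x) y (P' z) w) x y z
       = cyclic_sum (\<lambda>x y z. form_app g (D x y + D y x) (D z w + D w z)) x y z"
proof -
  interpret smooth_manifold A
    using assms by (simp add: riemannian_W3_def riemannian_almost_product_def)
  interpret W3_manifold A g nabla P
    using assms
    by unfold_locales (simp_all add: riemannian_W3_def riemannian_almost_product_def)
  show ?thesis
    unfolding R_def P'_def D_def by (rule curvature4_cyclic) fact+
qed

end
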